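(* Let $K$ be a field, $S=K[x_1,\ldots,x_n]$, and let $\mathcal M=(\mu_{i,j})$ be the matrix of generators of a strongly stable monomial ideal $I\subset S$. Then the following conditions hold: (i) Each non-zero row vector $(\mu_{1,j},\mu_{2,j},\ldots,\mu_{n,j})$ of $\mathcal M$ is an $O$-sequence such that $\mu_{2,j}\le j$. (ii) For all $i$ and $j$ one has $\mu_{i,j}\ge\sum_{q=1}^i\mu_{q,j-1}$.
   Context: A monomial ideal $I\subset S$ is strongly stable if for every monomial $u\in I$, every $j$ such that $x_j$ divides $u$, and every $i<j$, one has $(u/x_j)x_i\in I$. For a monomial $u\neq 1$, $m(u)$ is the largest index $e$ such that $x_e$ divides $u$. For a strongly stable ideal $J$ with minimal set of monomial generators $G(J)$, $m_i(J)$ is the number of $u\in G(J)$ with $m(u)=i$. For an ideal $I$, $I_{\langle j\rangle}$ is the ideal generated by the degree-$j$ elements of $I$. The matrix of generators of a strongly stable ideal $I$ is the matrix $\mathcal M(I)=(\mu_{i,j}(I))$ with $\mu_{i,j}(I)=m_i(I_{\langle j\rangle})$, where $i=1,\ldots,n$ indexes columns and $j=1,2,3,\ldots$ indexes (infinitely many) rows; by convention $\mu_{i,0}=0$. For a natural number $a$ and a positive integer $d$, with $d$-th Macaulay representation $a=\sum_{i=1}^d\binom{k(i)}{i}$, $k(d)>k(d-1)>\cdots>k(1)\ge0$ (which is unique), set $a^{\langle d\rangle}=\sum_{i=1}^d\binom{k(i)+1}{i+1}$. A vector $(m_1,\ldots,m_n)$ of natural numbers is called an $O$-sequence if $m_1=1$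 and $m_{i+1}\le m_i^{\langle i-1\rangle}$ for all $i=2,\ldots,n-1$. *)

theory Defs
  imports "HOL-Library.Poly_Mapping" "HOL-Algebra.Ideal"
begin

text \<open>
  A monomial in \<open>x\<^sub>1, \<dots>, x\<^sub>n\<close> is represented by its exponent vector, a finitely supported function
  \<open>nat \<Rightarrow>\<^sub>0 nat\<close> with support in \<open>{1..n}\<close>; the monomial 1 is the exponent vector 0. A polynomial is a
  finitely supported function from exponent vectors to coefficients, whose multiplication in
  \<^theory>\<open>HOL-Library.Poly_Mapping\<close> is convolution.
\<close>

definition monomials :: "nat \<Rightarrow> (nat \<Rightarrow>\<^sub>0 nat) set" where
  "monomials n = {a. Poly_Mapping.keys a \<subseteq> {1..n}}"

definition polynomial_ring :: "nat \<Rightarrow> ((nat \<Rightarrow>\<^sub>0 nat) \<Rightarrow>\<^sub>0 'k::field) ring" where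
  "polynomial_ring n =
     \<lparr>carrier = {f. Poly_Mapping.keys f \<subseteq> monomials n}, mult = (*), one = 1, zero = 0, add = (+)\<rparr>"

definition mono_poly :: "(nat \<Rightarrow>\<^sub>0 nat) \<Rightarrow> (nat \<Rightarrow>\<^sub>0 nat) \<Rightarrow>\<^sub>0 'k::field" where
  "mono_poly a = Poly_Mapping.single a 1"

definition mono_degree :: "(nat \<Rightarrow>\<^sub>0 nat) \<Rightarrow> nat" where
  "mono_degree a = (\<Sum>i\<in>Poly_Mapping.keys a. Poly_Mapping.lookup a i)"

lemma polynomial_ring_cring: "cring (polynomial_ring n :: ((nat \<Rightarrow>\<^sub>0 nat) \<Rightarrow>\<^sub>0 'k::field) ring)"
proof -
  have add: "Poly_Mapping.keys (f + g) \<subseteq> monomials n"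
    if "Poly_Mapping.keys f \<subseteq> monomials n" "Poly_Mapping.keys g \<subseteq> monomials n"
    for f g :: "(nat \<Rightarrow>\<^sub>0 nat) \<Rightarrow>\<^sub>0 'k"
    using that keys_add[of f g] by blast
  have "a + b \<in> monomials n" if "a \<in> monomials n" "b \<in> monomials n" for a b
    using that keys_add[of a b] unfolding monomials_def by blast
  then have mult: "Poly_Mapping.keys (f * g) \<subseteq> monomials n"
    if "Poly_Mapping.keys f \<subseteq> monomials n" "Poly_Mapping.keys g \<subseteq> monomials n"
    for f g :: "(nat \<Rightarrow>\<^sub>0 nat) \<Rightarrow>\<^sub>0 'k"
    using that keys_mult[of f g] by blast
  have one: "0 \<in> monomials n"
    by (simp add: monomials_def)
  show ?thesis
  proof (rule cringI)
    show "abelian_group (polynomial_ring n :: ((nat \<Rightarrow>\<^sub>0 nat) \<Rightarrow>\<^sub>0 'k) ring)"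
    proof (rule abelian_groupI, goal_cases)
      case (6 f)
      then show ?case
        by (intro bexI[of _ "- f"]) (auto simp: polynomial_ring_def)
    qed (auto simp: polynomial_ring_def add add_ac dest: subsetD[OF add])
    show "Group.comm_monoid (polynomial_ring n :: ((nat \<Rightarrow>\<^sub>0 nat) \<Rightarrow>\<^sub>0 'k) ring)"
      by (rule comm_monoidI)
        (auto simp: polynomial_ring_def mult one mult_ac dest: subsetD[OF mult])
  qed (simp add: polynomial_ring_def distrib_right)
qed

definition monomial_ideal :: "nat \<Rightarrow> ((nat \<Rightarrow>\<^sub>0 nat) \<Rightarrow>\<^sub>0 'k::field) set \<Rightarrow> bool" where
  "monomial_ideal n I \<longleftrightarrow>
     (\<exists>A \<subseteq> monomials n. I = Idl\<^bsub>polynomial_ring n\<^esub> (mono_poly ` A))"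

text \<open>
  For \<open>j \<in> keys a\<close>, the exponent vector of \<open>(u/x\<^sub>j)x\<^sub>i\<close>, where \<open>u\<close> has exponent vector \<open>a\<close>, is \<open>a - e\<^sub>j + e\<^sub>i\<close>;
  the truncated subtraction on \<open>nat \<Rightarrow>\<^sub>0 nat\<close> is exact here.
\<close>

definition strongly_stable :: "nat \<Rightarrow> ((nat \<Rightarrow>\<^sub>0 nat) \<Rightarrow>\<^sub>0 'k::field) set \<Rightarrow> bool" where
  "strongly_stable n I \<longleftrightarrow> monomial_ideal n I \<and>
     (\<forall>a\<in>monomials n. mono_poly a \<in> I \<longrightarrow>
        (\<forall>j\<in>Poly_Mapping.keys a. \<forall>i. 1 \<le> i \<and> i < j \<longrightarrow>
           mono_poly (a - Poly_Mapping.single j 1 + Poly_Mapping.single i 1) \<in> I))"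

text \<open>The minimal monomial generating set of a monomial ideal exists and is unique.\<close>

definition min_gens :: "nat \<Rightarrow> ((nat \<Rightarrow>\<^sub>0 nat) \<Rightarrow>\<^sub>0 'k::field) set \<Rightarrow> (nat \<Rightarrow>\<^sub>0 nat) set" where
  "min_gens n J = (THE G. G \<subseteq> monomials n
     \<and> Idl\<^bsub>polynomial_ring n\<^esub> (mono_poly ` G) = J
     \<and> (\<forall>H. H \<subset> G \<longrightarrow> Idl\<^bsub>polynomial_ring n\<^esub> (mono_poly ` H) \<noteq> J))"

definition max_var :: "(nat \<Rightarrow>\<^sub>0 nat) \<Rightarrow> nat" where
  "max_var a = Max (Poly_Mapping.keys a)"

text \<open>The monomial 1 has no largest variable and is therefore not counted.\<close>

definition num_gens :: "nat \<Rightarrow> nat \<Rightarrow> ((nat \<Rightarrow>\<^sub>0 nat) \<Rightarrow>\<^sub>0 'k::field) set \<Rightarrow> nat" where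
  "num_gens n i J = card {a \<in> min_gens n J. a \<noteq> 0 \<and> max_var a = i}"

definition degree_part_ideal ::
    "nat \<Rightarrow> nat \<Rightarrow> ((nat \<Rightarrow>\<^sub>0 nat) \<Rightarrow>\<^sub>0 'k::field) set \<Rightarrow> ((nat \<Rightarrow>\<^sub>0 nat) \<Rightarrow>\<^sub>0 'k) set" where
  "degree_part_ideal n j I = Idl\<^bsub>polynomial_ring n\<^esub> {f \<in> I. \<forall>a\<in>Poly_Mapping.keys f. mono_degree a = j}"

definition gens_matrix :: "nat \<Rightarrow> ((nat \<Rightarrow>\<^sub>0 nat) \<Rightarrow>\<^sub>0 'k::field) set \<Rightarrow> nat \<Rightarrow> nat \<Rightarrow> nat" where
  "gens_matrix n I i j = (if j = 0 then 0 else num_gens n i (degree_part_ideal n j I))"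

definition macaulay_rep :: "nat \<Rightarrow> nat \<Rightarrow> (nat \<Rightarrow> nat) \<Rightarrow> bool" where
  "macaulay_rep d a k \<longleftrightarrow>
     a = (\<Sum>i=1..d. k i choose i) \<and> (\<forall>i\<in>{1..<d}. k i < k (i + 1))"

text \<open>
  The function \<open>k\<close> in a Macaulay representation is unique only on \<open>{1..d}\<close>, so the definite description
  is of the resulting number rather than of \<open>k\<close>.
\<close>

definition macaulay_power :: "nat \<Rightarrow> nat \<Rightarrow> nat" where
  "macaulay_power a d =
     (THE b. \<exists>k. macaulay_rep d a k \<and> b = (\<Sum>i=1..d. (k i + 1) choose (i + 1)))"

text \<open>The vector \<open>(m\<^sub>1, \<dots>, m\<^sub>n)\<close> is the restriction of \<open>m\<close> to \<open>{1..n}\<close>.\<close>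

definition O_sequence :: "nat \<Rightarrow> (nat \<Rightarrow> nat) \<Rightarrow> bool" where
  "O_sequence n m \<longleftrightarrow>
     m 1 = 1 \<and> (\<forall>i\<in>{2..n - 1}. m (i + 1) \<le> macaulay_power (m i) (i - 1))"

end

theory Submission
  imports Defs
begin

text \<open>
  All monomials of degree \<open>j\<close> in \<open>I\<close> are minimal generators of the ideal generated by the degree-\<open>j\<close> part of
  \<open>I\<close>, so \<open>\<mu>\<^bsub>i,j\<^esub>\<close> counts the monomials \<open>u\<close> of degree \<open>j\<close> in \<open>I\<close> with largest variable \<open>x\<^sub>i\<close>
  (\<open>gens_matrix_eq_card\<close>). Multiplying by \<open>x\<^sub>i\<close> gives part (ii) at once (\<open>gens_matrix_sum_le\<close>).

  For part (i), let \<open>L\<close> be the set of monomials of degree \<open>j\<close> in \<open>I\<close>. A monomial of degree \<open>j\<close> is determined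
  by its degrees in \<open>x\<^sub>k, \<dots>, x\<^sub>n\<close> for all \<open>k\<close>, and strong stability makes \<open>L\<close> closed under lowering these
  numbers (\<open>stable_set_dominance\<close>). If \<open>u\<close> has largest variable \<open>x\<^bsub>d+1\<^esub>\<close>, its degrees for
  \<open>k = d + 1, \<dots>, 2\<close>, lowered by one, form a sorted list of length \<open>d\<close> with entries less than \<open>j\<close>, and
  \<open>\<mu>\<^bsub>d+1,j\<^esub>\<close> is the number of such lists coming from \<open>L\<close> (\<open>card_tail_lists\<close>). For \<open>d = 0\<close> there is only the
  empty list, and for \<open>d = 1\<close> there are at most \<open>j\<close> lists.

  The lists of length \<open>d\<close> form an order ideal \<open>N\<close> for entrywise comparison, and removing the first entry of
  one of length \<open>d + 1\<close> gives one of length \<open>d\<close>. Hence there are at most \<open>S N\<close> lists of length \<open>d + 1\<close>, where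
  \<open>S N\<close> is the sum of \<open>hd v + 1\<close> over \<open>v \<in> N\<close>. It remains to see that \<open>S N\<close> is at most the \<open>d\<close>-th
  Macaulay power of \<open>card N\<close> for every finite order ideal \<open>N\<close> of lists of length \<open>d \<ge> 1\<close>
  (\<open>order_ideal_growth\<close>), which is Macaulay's theorem for strongly stable sets. It follows by induction from
  splitting \<open>N\<close> according to whether the first entry is zero and from an inequality between Macaulay
  powers (\<open>binomial_sum_recursion\<close>).
\<close>

section \<open>Macaulay representations\<close>

definition increasing_on :: "nat \<Rightarrow> (nat \<Rightarrow> nat) \<Rightarrow> bool" where
  "increasing_on d k \<longleftrightarrow> (\<forall>i\<in>{1..<d}. k i < k (i + 1))"

text \<open>
  For \<open>k\<close> increasing on \<open>{1..d}\<close>, the value at \<open>s = 0\<close> is the number that \<open>k\<close> represents and the value at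
  \<open>s = 1\<close> is its Macaulay power. Keeping \<open>s\<close> as a parameter lets one lexicographic argument serve both.
\<close>

definition binomial_sum :: "nat \<Rightarrow> nat \<Rightarrow> (nat \<Rightarrow> nat) \<Rightarrow> nat" where
  "binomial_sum s d k = (\<Sum>i=1..d. (k i + s) choose (i + s))"

lemma binomial_sum_0 [simp]: "binomial_sum s 0 k = 0"
  by (simp add: binomial_sum_def)

lemma binomial_sum_Suc [simp]:
  "binomial_sum s (Suc d) k = binomial_sum s d k + ((k (Suc d) + s) choose (Suc d + s))"
  by (simp add: binomial_sum_def)

lemma increasing_on_Suc:
  "increasing_on (Suc d) k \<longleftrightarrow> increasing_on d k \<and> (d = 0 \<or> k d < k (Suc d))"
  by (auto simp: increasing_on_def less_Suc_eq)

text \<open>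
  For \<open>s = 0\<close> this shows that the top entry \<open>k d\<close> of a Macaulay representation is the largest \<open>m\<close> for
  which \<open>m choose d\<close> is at most the number represented. The proof is repeated use of Pascal's rule.
\<close>

lemma binomial_sum_less:
  assumes "d \<ge> 1" "increasing_on d k"
  shows "binomial_sum s d k < (k d + 1 + s) choose (d + s)"
  using assms
proof (induction d rule: dec_induct)
  case base
  show ?case by (simp add: numeral_2_eq_2)
next
  case (step d)
  have "binomial_sum s d k < (k d + 1 + s) choose (d + s)"
    using step by (simp add: increasing_on_Suc)
  also have "\<dots> \<le> (k (Suc d) + s) choose (d + s)"
    using step by (intro binomial_right_mono) (auto simp: increasing_on_Suc)
  finally show ?case by simp
qed

text \<open>
  The order of the binomial sums is the lexicographic order of the sequences, read from index \<open>d\<close>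
  downwards, whatever the shift. Hence the Macaulay power is well defined and strictly increasing.
\<close>

lemma binomial_sum_less_imp_less:
  assumes "increasing_on d k" "increasing_on d l" "binomial_sum s d k < binomial_sum s d l"
  shows "binomial_sum t d k < binomial_sum t d l"
  using assms
proof (induction d)
  case (Suc d)
  have lt: "binomial_sum r (Suc d) f < binomial_sum r (Suc d) g"
    if "increasing_on (Suc d) f" "f (Suc d) < g (Suc d)" for r f g
  proof -
    have "binomial_sum r (Suc d) f < (f (Suc d) + 1 + r) choose (Suc d + r)"
      by (rule binomial_sum_less) (use that in auto)
    also have "\<dots> \<le> (g (Suc d) + r) choose (Suc d + r)"
      by (rule binomial_right_mono) (use that in auto)
    also have "\<dots> \<le> binomial_sum r (Suc d) g" by simp
    finally show ?thesis .
  qed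
  consider "k (Suc d) < l (Suc d)" | "l (Suc d) < k (Suc d)" | "k (Suc d) = l (Suc d)"
    by linarith
  then show ?case
  proof cases
    case 1
    then show ?thesis using Suc.prems lt by blast
  next
    case 2
    then show ?thesis using Suc.prems lt[of l k s] by simp
  next
    case 3
    then show ?thesis using Suc by (auto simp: increasing_on_Suc)
  qed
qed simp

lemma binomial_sum_le_imp_le:
  assumes "increasing_on d k" "increasing_on d l" "binomial_sum s d k \<le> binomial_sum s d l"
  shows "binomial_sum t d k \<le> binomial_sum t d l"
  using binomial_sum_less_imp_less[OF assms(2,1), of t s] assms(3) by linarith

lemma macaulay_rep_iff:
  "macaulay_rep d a k \<longleftrightarrow> increasing_on d k \<and> a = binomial_sum 0 d k"
  by (auto simp: macaulay_rep_def increasing_on_def binomial_sum_def)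

lemma macaulay_power_eq:
  assumes "macaulay_rep d a k"
  shows "macaulay_power a d = binomial_sum 1 d k"
  unfolding macaulay_power_def
proof (rule the_equality)
  show "\<exists>l. macaulay_rep d a l \<and> binomial_sum 1 d k = (\<Sum>i=1..d. (l i + 1) choose (i + 1))"
    using assms by (auto simp: binomial_sum_def)
next
  fix b
  assume "\<exists>l. macaulay_rep d a l \<and> b = (\<Sum>i=1..d. (l i + 1) choose (i + 1))"
  then obtain l where "macaulay_rep d a l" "b = binomial_sum 1 d l"
    by (auto simp: binomial_sum_def)
  then show "b = binomial_sum 1 d k"
    using assms binomial_sum_le_imp_le[of d k l 0 1] binomial_sum_le_imp_le[of d l k 0 1]
    by (auto simp: macaulay_rep_iff)
qed

lemma macaulay_rep_exists:
  assumes "d \<ge> 1"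
  shows "\<exists>k. macaulay_rep d a k"
  using assms
proof (induction d arbitrary: a rule: dec_induct)
  case base
  show ?case by (rule exI[of _ "\<lambda>_. a"]) (simp add: macaulay_rep_def)
next
  case (step d)
  have bound: "m \<le> a + d" if "m choose Suc d \<le> a" for m
  proof (rule ccontr)
    assume "\<not> m \<le> a + d"
    then have "(Suc (a + d)) choose Suc d \<le> m choose Suc d"
      by (intro binomial_right_mono) auto
    moreover have "Suc a \<le> (Suc (a + d)) choose Suc d"
    proof (induction a)
      case (Suc a)
      have "1 \<le> (Suc (a + d)) choose d"
        by (simp add: Suc_le_eq)
      then show ?case using Suc by simp
    qed simp
    ultimately show False using that by simp
  qed
  \<comment> \<open>The representation is greedy: the top entry is as large as possible.\<close>
  define m where "m = (GREATEST m. m choose Suc d \<le> a)"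
  have m: "m choose Suc d \<le> a"
    unfolding m_def by (rule GreatestI_nat[where b = "a + d" and k = 0]) (use bound in auto)
  have "\<not> Suc m choose Suc d \<le> a"
    using Greatest_le_nat[of "\<lambda>m. m choose Suc d \<le> a" "Suc m" "a + d"] bound
    by (auto simp: m_def)
  then have rest: "a - (m choose Suc d) < m choose d"
    using m by simp
  obtain k where k: "macaulay_rep d (a - (m choose Suc d)) k"
    using step.IH by blast
  have "k d < m"
  proof (rule ccontr)
    assume "\<not> k d < m"
    then have "m choose d \<le> k d choose d" by (intro binomial_right_mono) auto
    also have "\<dots> \<le> binomial_sum 0 d k"
      using step.hyps by (cases d) auto
    finally show False using rest k by (simp add: macaulay_rep_iff)
  qed
  then have "macaulay_rep (Suc d) a (k(Suc d := m))"
    using k m by (auto simp: macaulay_rep_def less_Suc_eq)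
  then show ?case by blast
qed

text \<open>
  The numerical core of the induction below. If \<open>a = b + c\<close> with \<open>c \<ge> 1\<close> and, when \<open>d \<ge> 2\<close>, the
  \<open>(d - 1)\<close>-st Macaulay power of \<open>c\<close> is at least \<open>a\<close>, then the \<open>d\<close>-th Macaulay powers of \<open>a\<close> and \<open>b\<close> differ
  by at least \<open>a\<close>. Here \<open>k\<close>, \<open>l\<close> and \<open>h\<close> represent \<open>a\<close>, \<open>b\<close> and \<open>c\<close>. Lowering every nonzero term
  \<open>k i choose i\<close> to \<open>(k i - 1) choose i\<close> gives a number \<open>a'\<close> whose Macaulay power is the power of \<open>a\<close> minus
  \<open>a\<close>, so it is enough to prove \<open>b \<le> a'\<close>. Otherwise \<open>c < a - a'\<close>, and \<open>a - a'\<close> is, up to the term for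
  \<open>i = 1\<close>, represented in degree \<open>d - 1\<close> by \<open>k (i + 1) - 1\<close>; then the Macaulay power of \<open>c\<close> would be less
  than \<open>a\<close>, or \<open>c\<close> would be zero if \<open>d = 1\<close>.
\<close>

lemma binomial_sum_recursion:
  assumes d: "d \<ge> 1" and k: "increasing_on d k" and l: "increasing_on d l"
    and sum: "binomial_sum 0 d k = binomial_sum 0 d l + c"
    and c: "c \<ge> 1"
    and h: "d \<ge> 2 \<Longrightarrow> increasing_on (d - 1) h \<and> c = binomial_sum 0 (d - 1) h \<and>
             binomial_sum 0 d k \<le> binomial_sum 1 (d - 1) h"
  shows "binomial_sum 0 d k + binomial_sum 1 d l \<le> binomial_sum 1 d k"
proof -
  \<comment> \<open>Terms with \<open>k i = i - 1\<close> vanish and must not be lowered, since \<open>k'\<close> has to stay increasing.\<close>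
  define k' where "k' i = max (k i - 1) (i - 1)" for i
  define g where "g i = k (i + 1) - 1" for i
  have ge: "i - 1 \<le> k i" if "1 \<le> i" "i \<le> d" for i
    using that
  proof (induction i rule: dec_induct)
    case (step i)
    then have "k i < k (i + 1)" using k by (simp add: increasing_on_def)
    then show ?case using step by simp
  qed simp
  have k': "increasing_on d k'"
    unfolding increasing_on_def
  proof
    fix i assume i: "i \<in> {1..<d}"
    then have "k i < k (i + 1)" using k by (simp add: increasing_on_def)
    then show "k' i < k' (i + 1)" using i by (auto simp: k'_def)
  qed
  have g: "increasing_on (d - 1) g"
    unfolding increasing_on_def
  proof
    fix i assume i: "i \<in> {1..<d - 1}"
    then have "k (i + 1) < k (i + 2)" using k by (auto simp: increasing_on_def)
    then show "g i < g (i + 1)" using ge[of "i + 1"] i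
      by (fastforce simp: g_def intro: diff_less_mono)
  qed
  have split: "k i choose i = (k' i choose i) + (if i \<le> k i then (k i - 1) choose (i - 1) else 0)"
    if i: "i \<in> {1..d}" for i
  proof -
    obtain i' where i': "i = Suc i'" using i by (cases i) auto
    show ?thesis
    proof (cases "i \<le> k i")
      case True
      then obtain m where m: "k i = Suc m" using i' by (cases "k i") auto
      show ?thesis using True m i' by (simp add: k'_def max_def)
    next
      case False
      then have "k i = i'" using ge[of i] i i' by auto
      then show ?thesis by (simp add: k'_def i')
    qed
  qed
  have lift: "(k i + 1) choose (i + 1) = (k i choose i) + ((k' i + 1) choose (i + 1))"
    if i: "i \<in> {1..d}" for i
  proof -
    obtain i' where i': "i = Suc i'" using i by (cases i) auto
    show ?thesis
    proof (cases "i \<le> k i")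
      case True
      then obtain m where m: "k i = Suc m" using i' by (cases "k i") auto
      show ?thesis using True m i' by (simp add: k'_def max_def)
    next
      case False
      then have "k i = i'" using ge[of i] i i' by auto
      then show ?thesis by (simp add: k'_def i')
    qed
  qed
  have lifted: "binomial_sum 1 d k = binomial_sum 0 d k + binomial_sum 1 d k'"
    unfolding binomial_sum_def sum.distrib[symmetric]
    by (rule sum.cong[OF refl]) (simp only: lift add_0_right)
  have "binomial_sum 0 d l \<le> binomial_sum 0 d k'"
  proof (rule ccontr)
    assume "\<not> ?thesis"
    have shift: "(\<Sum>i=1..d. f i) = f 1 + (\<Sum>i=1..d-1. f (i + 1))" for f :: "nat \<Rightarrow> nat"
      using d sum.atLeast_Suc_atMost[of 1 d f] sum.shift_bounds_cl_Suc_ivl[of f 1 "d - 1"]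
      by simp
    have "binomial_sum 0 d k =
        binomial_sum 0 d k' + (\<Sum>i=1..d. if i \<le> k i then (k i - 1) choose (i - 1) else 0)"
      unfolding binomial_sum_def by (simp add: sum.distrib[symmetric] split)
    also have "(\<Sum>i=1..d. if i \<le> k i then (k i - 1) choose (i - 1) else 0)
        = (if k 1 = 0 then 0 else 1) + (\<Sum>i=1..d-1. if i + 1 \<le> k (i + 1) then (k (i + 1) - 1) choose i else 0)"
      unfolding shift[of "\<lambda>i. if i \<le> k i then (k i - 1) choose (i - 1) else 0"] add_diff_cancel_right'
      by (simp add: Suc_le_eq)
    also have "(\<Sum>i=1..d-1. if i + 1 \<le> k (i + 1) then (k (i + 1) - 1) choose i else 0) = binomial_sum 0 (d-1) g"
      unfolding binomial_sum_def by (rule sum.cong) (auto simp: g_def)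
    finally have less: "c < (if k 1 = 0 then 0 else 1) + binomial_sum 0 (d - 1) g"
      using sum \<open>\<not> _\<close> by linarith
    show False
    proof (cases "d = 1")
      case True
      then show False using less c by (auto split: if_splits)
    next
      case False
      then have "d \<ge> 2" using d by simp
      note h = h[OF this]
      have "binomial_sum 0 d k = k 1 + (\<Sum>i=1..d-1. k (i + 1) choose (i + 1))"
        unfolding binomial_sum_def shift[of "\<lambda>i. (k i + 0) choose (i + 0)"] by simp
      also have "(\<Sum>i=1..d-1. k (i + 1) choose (i + 1)) = binomial_sum 1 (d - 1) g"
        unfolding binomial_sum_def
      proof (rule sum.cong)
        fix i assume "i \<in> {1..d - 1}"
        then show "k (i + 1) choose (i + 1) = (g i + 1) choose (i + 1)"
          using ge[of "i + 1"] by (cases "k (i + 1)") (auto simp: g_def)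
      qed simp
      finally have gk: "binomial_sum 0 d k = k 1 + binomial_sum 1 (d - 1) g" .
      show False
      proof (cases "k 1 = 0")
        case True
        then show False
          using binomial_sum_less_imp_less[of "d - 1" h g 0 1] h g less gk by simp
      next
        case False
        then show False
          using binomial_sum_le_imp_le[of "d - 1" h g 0 1] h g less gk by simp
      qed
    qed
  qed
  then have "binomial_sum 1 d l \<le> binomial_sum 1 d k'"
    using binomial_sum_le_imp_le[OF l k'] by blast
  then show ?thesis using lifted by simp
qed


section \<open>Growth of order ideals of sorted lists\<close>

text \<open>
  A sorted list \<open>v\<close> of \<open>d\<close> natural numbers encodes the monomial of degree \<open>d\<close> in variables
  \<open>y\<^sub>0, y\<^sub>1, \<dots>\<close> whose factors are the \<open>y\<close> with indices in \<open>v\<close>, smallest index first. An order ideal is a set of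
  such lists closed under lowering entries, that is, under replacing variables by earlier ones.
\<close>

definition order_ideal :: "nat \<Rightarrow> nat list set \<Rightarrow> bool" where
  "order_ideal d N \<longleftrightarrow> (\<forall>v\<in>N. length v = d \<and> sorted v) \<and>
     (\<forall>v\<in>N. \<forall>w. sorted w \<and> list_all2 (\<le>) w v \<longrightarrow> w \<in> N)"

lemma order_idealD:
  assumes "order_ideal d N" "v \<in> N"
  shows "length v = d" "sorted v"
  using assms by (auto simp: order_ideal_def)

lemma order_ideal_closed:
  assumes "order_ideal d N" "v \<in> N" "sorted w" "list_all2 (\<le>) w v"
  shows "w \<in> N"
  using assms unfolding order_ideal_def by blast

lemma list_all2_le_refl: "list_all2 (\<le>) (v :: nat list) v"
  by (simp add: list_all2_refl)

lemma order_ideal_zero_head: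
  assumes "order_ideal (Suc d) N" "t # v \<in> N"
  shows "0 # v \<in> N"
  by (rule order_ideal_closed[OF assms])
    (use order_idealD(2)[OF assms] in \<open>auto simp: list_all2_le_refl\<close>)

text \<open>
  A sorted list with tail \<open>v\<close> is determined by \<open>v\<close> and a head \<open>t \<le> hd v\<close>, for which there are \<open>Suc (hd v)\<close>
  possibilities.
\<close>

lemma card_extension_le:
  assumes fin: "finite C" and "d \<ge> 1"
    and sorted: "\<And>w. w \<in> N \<Longrightarrow> sorted w"
    and len: "\<And>v. v \<in> C \<Longrightarrow> length v = d"
    and ex: "\<And>w. w \<in> N \<Longrightarrow> \<exists>t v. w = t # v \<and> v \<in> C"
  shows "card N \<le> (\<Sum>v\<in>C. Suc (hd v))"
proof -
  have "N \<subseteq> (\<lambda>(v, t). t # v) ` (SIGMA v:C. {..hd v})"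
  proof
    fix w assume w: "w \<in> N"
    then obtain t v where tv: "w = t # v" "v \<in> C" using ex by blast
    then have "v \<noteq> []" using len[of v] \<open>d \<ge> 1\<close> by auto
    then have "t \<le> hd v" using sorted[OF w] tv by (cases v) auto
    then show "w \<in> (\<lambda>(v, t). t # v) ` (SIGMA v:C. {..hd v})" using tv by force
  qed
  then have "card N \<le> card (SIGMA v:C. {..hd v})"
    by (rule surj_card_le[rotated]) (use fin in auto)
  also have "\<dots> = (\<Sum>v\<in>C. Suc (hd v))" using fin by simp
  finally show ?thesis .
qed

text \<open>
  Macaulay's bound in this setting. The set \<open>N\<close> is split by whether the head is zero: \<open>C\<close> consists of the
  tails of the lists with zero head, and \<open>B\<close> of the other lists with all entries lowered by one. Both are
  order ideals, in degree \<open>d - 1\<close> and \<open>d\<close>, and the sum \<open>S N\<close> on the left-hand side satisfies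
  \<open>S N = card N + S B\<close> and, for \<open>d \<ge> 2\<close>, \<open>card N \<le> S C\<close>. Induction on \<open>d\<close> bounds \<open>S C\<close> and induction on \<open>card N\<close> bounds
  \<open>S B\<close>.
\<close>

lemma order_ideal_growth:
  assumes "d \<ge> 1" "finite N" "order_ideal d N" "macaulay_rep d (card N) k"
  shows "(\<Sum>v\<in>N. Suc (hd v)) \<le> binomial_sum 1 d k"
  using assms
proof (induction d arbitrary: N k)
  case 0
  then show ?case by simp
next
  case (Suc d)
  note outer = Suc.IH
  show ?case using Suc.prems
  proof (induction "card N" arbitrary: N k rule: less_induct)
    case less
    note fin = less.prems(2) and ord = less.prems(3)
    show ?case
    proof (cases "N = {}")
      case False
      define B where "B = {v. map Suc v \<in> N}"
      define C where "C = {v. 0 # v \<in> N}"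
      have finB: "finite B" and finC: "finite C"
        unfolding B_def C_def
        using finite_vimageI[OF fin, of "map Suc"] finite_vimageI[OF fin, of "(#) 0"]
        by (auto simp: vimage_def inj_def)
      have N: "N = map Suc ` B \<union> (#) 0 ` C"
      proof (intro equalityI subsetI)
        fix w assume w: "w \<in> N"
        have "length w = Suc d" "sorted w" using order_idealD[OF ord w] by auto
        then obtain t v where tv: "w = t # v" "sorted (t # v)" by (cases w) auto
        show "w \<in> map Suc ` B \<union> (#) 0 ` C"
        proof (cases "t = 0")
          case True
          then show ?thesis using w tv by (auto simp: C_def)
        next
          case False
          then have "\<forall>x\<in>set w. 1 \<le> x" using tv by force
          then have "map Suc (map (\<lambda>x. x - 1) w) = w"
            by (auto intro!: map_idI)
          then show ?thesis using w unfolding B_def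
            by (intro UnI1 image_eqI[of _ _ "map (\<lambda>x. x - 1) w"]) simp_all
        qed
      qed (auto simp: B_def C_def)
      have lenB: "length v = Suc d" if "v \<in> B" for v
        using that order_idealD(1)[OF ord, of "map Suc v"] by (simp add: B_def)
      have disj: "map Suc ` B \<inter> (#) 0 ` C = {}"
        using lenB by auto
      have injS: "inj_on (map Suc) B" by (rule inj_on_subset[OF inj_mapI]) auto
      have injC: "inj_on ((#) 0) C" by (simp add: inj_on_def)
      have card: "card N = card B + card C"
        unfolding N using finB finC disj
        by (subst card_Un_disjoint) (auto simp: card_image injS injC)
      have ordB: "order_ideal (Suc d) B"
        unfolding order_ideal_def
      proof (intro conjI ballI allI impI)
        fix v w assume v: "v \<in> B" and w: "sorted w \<and> list_all2 (\<le>) w v"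
        have "sorted (map Suc w)"
          using w by (simp add: sorted_map)
        moreover have "list_all2 (\<le>) (map Suc w) (map Suc v)"
          using w by (simp add: list_all2_conv_all_nth)
        ultimately have "map Suc w \<in> N"
          using order_ideal_closed[OF ord, of "map Suc v"] v by (simp add: B_def)
        then show "w \<in> B" by (simp add: B_def)
      next
        fix v assume v: "v \<in> B"
        then have "sorted (map Suc v)" using order_idealD(2)[OF ord] by (simp add: B_def)
        then show "sorted v" by (simp add: sorted_map)
      qed (rule lenB)
      have ordC: "order_ideal d C"
        unfolding order_ideal_def
      proof (intro conjI ballI allI impI)
        fix v w assume "v \<in> C" "sorted w \<and> list_all2 (\<le>) w v"
        then show "w \<in> C"
          using order_ideal_closed[OF ord, of "0 # v" "0 # w"] by (auto simp: C_def)
      next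
        fix v assume "v \<in> C"
        then show "length v = d" "sorted v"
          using order_idealD[OF ord, of "0 # v"] by (auto simp: C_def)
      qed
      have "C \<noteq> {}"
      proof -
        obtain w where w: "w \<in> N" using False by blast
        then have "length w = Suc d" using order_idealD[OF ord] by blast
        then obtain t v where "w = t # v" by (cases w) auto
        then show ?thesis using order_ideal_zero_head[OF ord, of t v] w by (auto simp: C_def)
      qed
      then have C1: "card C \<ge> 1" using finC by (simp add: Suc_le_eq card_gt_0_iff)
      obtain l where l: "macaulay_rep (Suc d) (card B) l"
        using macaulay_rep_exists[of "Suc d"] by auto
      have "(\<Sum>v\<in>N. Suc (hd v)) = (\<Sum>v\<in>map Suc ` B. Suc (hd v)) + (\<Sum>v\<in>(#) 0 ` C. Suc (hd v))"
        by (subst N, rule sum.union_disjoint) (use finB finC disj in auto)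
      also have "(\<Sum>v\<in>map Suc ` B. Suc (hd v)) = (\<Sum>v\<in>B. Suc (hd v) + 1)"
      proof (subst sum.reindex[OF injS], rule sum.cong)
        fix v assume "v \<in> B"
        then have "v \<noteq> []" using lenB by fastforce
        then show "((\<lambda>v. Suc (hd v)) \<circ> map Suc) v = Suc (hd v) + 1" by (simp add: hd_map)
      qed simp
      also have "\<dots> = (\<Sum>v\<in>B. Suc (hd v)) + card B" by (simp only: sum.distrib) simp
      also have "(\<Sum>v\<in>(#) 0 ` C. Suc (hd v)) = card C"
        by (subst sum.reindex[OF injC]) simp
      also have "(\<Sum>v\<in>B. Suc (hd v)) \<le> binomial_sum 1 (Suc d) l"
        by (rule less.hyps) (use card C1 finB ordB l in auto)
      finally have S: "(\<Sum>v\<in>N. Suc (hd v)) \<le> card N + binomial_sum 1 (Suc d) l"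
        using card by simp
      obtain h where h: "d \<ge> 1 \<Longrightarrow> macaulay_rep d (card C) h"
        using macaulay_rep_exists[of d] by blast
      have "card N \<le> binomial_sum 1 d h" if "d \<ge> 1"
      proof -
        have "card N \<le> (\<Sum>v\<in>C. Suc (hd v))"
        proof (rule card_extension_le[OF finC that])
          fix w assume w: "w \<in> N"
          then obtain t v where tv: "w = t # v"
            using order_idealD(1)[OF ord w] by (cases w) auto
          then show "\<exists>t v. w = t # v \<and> v \<in> C"
            using order_ideal_zero_head[OF ord, of t v] w by (auto simp: C_def)
        qed (use order_idealD ord ordC in blast)+
        also have "\<dots> \<le> binomial_sum 1 d h"
          by (rule outer) (use that finC ordC h in auto)
        finally show ?thesis .
      qed
      then have "card N + binomial_sum 1 (Suc d) l \<le> binomial_sum 1 (Suc d) k"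
        using binomial_sum_recursion[of "Suc d" k l "card C" h] less.prems(4) l h C1 card
        by (auto simp: macaulay_rep_iff)
      then show ?thesis using S by simp
    qed simp
  qed
qed

section \<open>Tail degrees of monomials\<close>

text \<open>
  The degree of the monomial \<open>u\<close> in the variables \<open>x\<^sub>k, \<dots>, x\<^sub>n\<close>. Replacing \<open>x\<^sub>q\<close> by \<open>x\<^sub>i\<close> with \<open>i < q\<close> lowers the
  tail degrees at \<open>i + 1, \<dots>, q\<close> by one and leaves the others unchanged.
\<close>

definition tail_degree :: "nat \<Rightarrow> (nat \<Rightarrow>\<^sub>0 nat) \<Rightarrow> nat \<Rightarrow> nat" where
  "tail_degree n u k = (\<Sum>q=k..n. Poly_Mapping.lookup u q)"

lemma tail_degree_add: "tail_degree n (u + w) k = tail_degree n u k + tail_degree n w k"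
  by (simp add: tail_degree_def lookup_add sum.distrib)

lemma tail_degree_single:
  "tail_degree n (Poly_Mapping.single a b) k = (if k \<le> a \<and> a \<le> n then b else 0)"
  by (simp add: tail_degree_def lookup_single when_def)

lemma tail_degree_rec:
  "k \<le> n \<Longrightarrow> tail_degree n u k = Poly_Mapping.lookup u k + tail_degree n u (Suc k)"
  by (simp add: tail_degree_def sum.atLeast_Suc_atMost)

lemma tail_degree_beyond: "n < k \<Longrightarrow> tail_degree n u k = 0"
  by (simp add: tail_degree_def)

lemma tail_degree_antimono: "k \<le> l \<Longrightarrow> tail_degree n u l \<le> tail_degree n u k"
  unfolding tail_degree_def by (rule sum_mono2) auto

lemma mono_degree_eq_tail_degree:
  assumes "u \<in> monomials n"
  shows "mono_degree u = tail_degree n u 1"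
  unfolding mono_degree_def tail_degree_def
  by (rule sum.mono_neutral_left)
    (use assms in \<open>auto simp: monomials_def in_keys_iff\<close>)

lemma monomials_eqI:
  assumes "u \<in> monomials n" "w \<in> monomials n"
    and eq: "\<And>k. 1 \<le> k \<Longrightarrow> k \<le> n \<Longrightarrow> tail_degree n u k = tail_degree n w k"
  shows "u = w"
proof (rule poly_mapping_eqI)
  fix k
  show "Poly_Mapping.lookup u k = Poly_Mapping.lookup w k"
  proof (cases "k \<in> {1..n}")
    case True
    then have "tail_degree n u k = tail_degree n w k"
      "tail_degree n u (Suc k) = tail_degree n w (Suc k)"
      using eq[of k] eq[of "Suc k"] by (cases "Suc k \<le> n"; simp add: tail_degree_beyond)+
    then show ?thesis using tail_degree_rec[of k n u] tail_degree_rec[of k n w] True by simp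
  next
    case False
    then have "k \<notin> Poly_Mapping.keys u" "k \<notin> Poly_Mapping.keys w"
      using assms(1,2) by (auto simp: monomials_def)
    then show ?thesis by (simp add: in_keys_iff)
  qed
qed

lemma exists_tail_degree:
  assumes anti: "\<And>k. 1 \<le> k \<Longrightarrow> k \<le> n \<Longrightarrow> T (Suc k) \<le> T k" and "T (Suc n) = 0"
  shows "\<exists>w\<in>monomials n. \<forall>k. 1 \<le> k \<and> k \<le> n \<longrightarrow> tail_degree n w k = T k"
proof -
  define w where "w = (\<Sum>k=1..n. Poly_Mapping.single k (T k - T (Suc k)))"
  have w: "Poly_Mapping.lookup w q = (if q \<in> {1..n} then T q - T (Suc q) else 0)" for q
    unfolding w_def by (simp add: lookup_sum lookup_single when_def)
  have "w \<in> monomials n"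
    by (auto simp: monomials_def in_keys_iff w split: if_splits)
  moreover have "tail_degree n w k = T k" if "1 \<le> k" "k \<le> Suc n" for k
    using that(2,1)
  proof (induction k rule: inc_induct)
    case base
    then show ?case using assms(2) by (simp add: tail_degree_beyond)
  next
    case (step k)
    then show ?case using anti[of k] by (simp add: tail_degree_rec w)
  qed
  ultimately show ?thesis by (intro bexI[of _ w]) auto
qed

lemma tail_degree_eq_0_iff:
  assumes "u \<in> monomials n"
  shows "tail_degree n u k = 0 \<longleftrightarrow> (\<forall>q\<in>Poly_Mapping.keys u. q < k)"
proof -
  have "tail_degree n u k = 0 \<longleftrightarrow> (\<forall>q\<in>{k..n}. q \<notin> Poly_Mapping.keys u)"
    by (simp add: tail_degree_def in_keys_iff)
  also have "\<dots> \<longleftrightarrow> (\<forall>q\<in>Poly_Mapping.keys u. q < k)"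
    using assms unfolding monomials_def by (fastforce simp: not_less)
  finally show ?thesis .
qed

lemma max_var_iff_tail_degree:
  assumes "u \<in> monomials n"
  shows "u \<noteq> 0 \<and> max_var u = i \<longleftrightarrow> tail_degree n u i > 0 \<and> tail_degree n u (Suc i) = 0"
proof (cases "u = 0")
  case False
  then have "max_var u = i \<longleftrightarrow> i \<in> Poly_Mapping.keys u \<and> (\<forall>q\<in>Poly_Mapping.keys u. q \<le> i)"
    unfolding max_var_def by (subst Max_eq_iff) auto
  also have "\<dots> \<longleftrightarrow> \<not> (\<forall>q\<in>Poly_Mapping.keys u. q < i) \<and> (\<forall>q\<in>Poly_Mapping.keys u. q < Suc i)"
    by (auto simp: less_Suc_eq_le order.order_iff_strict)
  finally show ?thesis
    using False by (simp only: tail_degree_eq_0_iff[OF assms] neq0_conv[symmetric] not_False_eq_True simp_thms)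
qed (simp add: tail_degree_def)

section \<open>Strongly stable sets of monomials of one degree\<close>

text \<open>
  A set of monomials of degree \<open>j\<close> that is closed under the exchanges defining strong stability.
\<close>

definition stable_set :: "nat \<Rightarrow> nat \<Rightarrow> (nat \<Rightarrow>\<^sub>0 nat) set \<Rightarrow> bool" where
  "stable_set n j L \<longleftrightarrow> L \<subseteq> {u \<in> monomials n. mono_degree u = j} \<and>
     (\<forall>u\<in>L. \<forall>q\<in>Poly_Mapping.keys u. \<forall>i. 1 \<le> i \<and> i < q \<longrightarrow>
        u - Poly_Mapping.single q 1 + Poly_Mapping.single i 1 \<in> L)"

lemma stable_setD:
  assumes "stable_set n j L" "u \<in> L"
  shows "u \<in> monomials n" "tail_degree n u 1 = j"
  using assms mono_degree_eq_tail_degree[of u n] unfolding stable_set_def by auto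

text \<open>
  A strongly stable set is closed downwards in the order given by comparing all tail degrees.
\<close>

lemma stable_set_dominance:
  assumes L: "stable_set n j L" and u: "u \<in> L" and w: "w \<in> monomials n" "mono_degree w = j"
    and le: "\<And>k. 1 \<le> k \<Longrightarrow> k \<le> n \<Longrightarrow> tail_degree n w k \<le> tail_degree n u k"
  shows "w \<in> L"
  using u le
proof (induction "\<Sum>k=1..n. tail_degree n u k" arbitrary: u rule: less_induct)
  case less
  note um = stable_setD[OF L less.prems(1)]
  show ?case
  proof (cases "u = w")
    case False
    \<comment> \<open>At the last index \<open>k\<close> where the tail degrees differ, \<open>x\<^sub>k\<close> divides \<open>u\<close> and can be replaced by \<open>x\<^bsub>k-1\<^esub>\<close>;
      here \<open>k \<noteq> 1\<close> because the total degrees agree.\<close>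
    define K where "K = {k \<in> {1..n}. tail_degree n w k < tail_degree n u k}"
    have "K \<noteq> {}"
    proof
      assume "K = {}"
      then have "u = w"
        using less.prems(2) by (intro monomials_eqI[OF um(1) w(1)]) (force simp: K_def)
      then show False using False by simp
    qed
    moreover have finK: "finite K" by (simp add: K_def)
    ultimately have "Max K \<in> K" by (rule Max_in[rotated])
    define k where "k = Max K"
    have k: "1 \<le> k" "k \<le> n" "tail_degree n w k < tail_degree n u k"
      using \<open>Max K \<in> K\<close> by (auto simp: k_def K_def)
    have "Suc k \<notin> K" using Max_ge[OF finK, of "Suc k"] by (auto simp: k_def)
    then have "tail_degree n u (Suc k) \<le> tail_degree n w (Suc k)"
      by (cases "Suc k \<le> n") (auto simp: K_def tail_degree_beyond)
    then have pos: "Poly_Mapping.lookup u k > 0"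
      using k tail_degree_rec[of k n u] tail_degree_rec[of k n w] by linarith
    have "k \<noteq> 1"
      using k um w mono_degree_eq_tail_degree[of w n] by auto
    then have k2: "1 \<le> k - 1" "k - 1 < k" using k by auto
    define s where "s = u - Poly_Mapping.single k 1"
    have us: "u = s + Poly_Mapping.single k 1"
      unfolding s_def using pos
      by (intro poly_mapping_eqI) (auto simp: lookup_add lookup_minus lookup_single when_def)
    define u' where "u' = s + Poly_Mapping.single (k - 1) 1"
    have u': "u' \<in> L"
      using L less.prems(1) pos k2 unfolding stable_set_def u'_def s_def
      by (auto simp: in_keys_iff)
    have tail: "tail_degree n u q = tail_degree n u' q + (if q = k then 1 else 0)" for q
      using k k2 by (auto simp: us u'_def tail_degree_add tail_degree_single)
    show ?thesis
    proof (rule less.hyps[OF _ u'])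
      have "(\<Sum>q=1..n. tail_degree n u q) = (\<Sum>q=1..n. tail_degree n u' q) + 1"
        using k by (simp add: tail sum.distrib)
      then show "(\<Sum>q=1..n. tail_degree n u' q) < (\<Sum>q=1..n. tail_degree n u q)" by simp
    next
      fix q assume "1 \<le> q" "q \<le> n"
      then show "tail_degree n w q \<le> tail_degree n u' q"
        using less.prems(2)[of q] tail[of q] k(3) by (auto split: if_splits)
    qed
  qed (use less.prems in simp)
qed

text \<open>
  A monomial \<open>u \<in> L\<close> with largest variable \<open>x\<^bsub>d+1\<^esub>\<close> gives the sorted list of its tail degrees at
  \<open>d + 1, d, \<dots>, 2\<close>, each lowered by one. (Reading \<open>u\<close> as a partition, this is conjugation.) The definition
  takes all sorted lists below the list of some \<open>u \<in> L\<close>, with no condition on the largest variable of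
  \<open>u\<close>, so that closure under lowering entries and under removing the head is immediate; that nothing new
  is added when \<open>L\<close> is strongly stable is the content of \<open>card_tail_lists\<close> below.
\<close>

definition tail_lists :: "nat \<Rightarrow> (nat \<Rightarrow>\<^sub>0 nat) set \<Rightarrow> nat \<Rightarrow> nat list set" where
  "tail_lists n L d = {v. length v = d \<and> sorted v \<and>
     (\<exists>u\<in>L. \<forall>i<d. v ! i < tail_degree n u (d + 1 - i))}"

lemma order_ideal_tail_lists: "order_ideal d (tail_lists n L d)"
  unfolding order_ideal_def
proof (intro conjI ballI allI impI)
  fix v w assume "v \<in> tail_lists n L d" and w: "sorted w \<and> list_all2 (\<le>) w v"
  then obtain u where v: "length v = d" and u: "u \<in> L"
    and less: "\<And>i. i < d \<Longrightarrow> v ! i < tail_degree n u (d + 1 - i)"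
    by (auto simp: tail_lists_def)
  have "w ! i < tail_degree n u (d + 1 - i)" if "i < d" for i
    using less[OF that] w v that by (auto simp: list_all2_conv_all_nth intro: le_less_trans)
  then show "w \<in> tail_lists n L d"
    using u v w by (auto simp: tail_lists_def dest: list_all2_lengthD)
qed (auto simp: tail_lists_def)

lemma tail_lists_tl:
  assumes "t # v \<in> tail_lists n L (Suc d)"
  shows "v \<in> tail_lists n L d"
proof -
  obtain u where u: "length v = d" "sorted v" "u \<in> L"
    and less: "\<And>i. i < Suc d \<Longrightarrow> (t # v) ! i < tail_degree n u (Suc d + 1 - i)"
    using assms by (auto simp: tail_lists_def)
  have "v ! i < tail_degree n u (d + 1 - i)" if "i < d" for i
    using less[of "Suc i"] that by simp
  then show ?thesis using u by (auto simp: tail_lists_def)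
qed

lemma finite_tail_lists:
  assumes "stable_set n j L"
  shows "finite (tail_lists n L d)"
proof (rule finite_subset)
  show "tail_lists n L d \<subseteq> {v. set v \<subseteq> {..<j} \<and> length v = d}"
  proof
    fix v assume "v \<in> tail_lists n L d"
    then obtain u where v: "length v = d" and u: "u \<in> L"
      and less: "\<And>i. i < d \<Longrightarrow> v ! i < tail_degree n u (d + 1 - i)"
      by (auto simp: tail_lists_def)
    have "v ! i < j" if "i < d" for i
    proof -
      have "1 \<le> d + 1 - i" using that by simp
      then show ?thesis
        using less[OF that] tail_degree_antimono[of 1 "d + 1 - i" n u] stable_setD(2)[OF assms u]
        by linarith
    qed
    then show "v \<in> {v. set v \<subseteq> {..<j} \<and> length v = d}"
      using v by (auto simp: in_set_conv_nth)
  qed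
qed (rule finite_lists_length_eq, simp)

text \<open>
  Coding by tail degrees is a bijection. Surjectivity uses dominance: the monomial decoded from a list
  lies below some element of \<open>L\<close>, hence in \<open>L\<close>.
\<close>

lemma card_tail_lists:
  assumes L: "stable_set n j L" and "j \<ge> 1" "d < n"
  shows "card {u \<in> L. u \<noteq> 0 \<and> max_var u = Suc d} = card (tail_lists n L d)"
proof (rule bij_betw_same_card)
  define code where "code u = map (\<lambda>i. tail_degree n u (d + 1 - i) - 1) [0..<d]" for u
  define M where "M = {u \<in> L. u \<noteq> 0 \<and> max_var u = Suc d}"
  have M: "u \<in> M \<longleftrightarrow> u \<in> L \<and> tail_degree n u (Suc d) > 0 \<and> tail_degree n u (Suc (Suc d)) = 0" for u
    unfolding M_def using max_var_iff_tail_degree[OF stable_setD(1)[OF L]] by auto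
  have pos: "tail_degree n u k > 0" if "u \<in> M" "k \<le> Suc d" for u k
    using that tail_degree_antimono[of k "Suc d" n u] by (simp add: M)
  have zero: "tail_degree n u k = 0" if "u \<in> M" "k > Suc d" for u k
    using that tail_degree_antimono[of "Suc (Suc d)" k n u] by (simp add: M)
  show "bij_betw code {u \<in> L. u \<noteq> 0 \<and> max_var u = Suc d} (tail_lists n L d)"
    unfolding bij_betw_def M_def[symmetric]
  proof (intro conjI subset_antisym subsetI)
    show "inj_on code M"
    proof (rule inj_onI)
      fix u w assume uw: "u \<in> M" "w \<in> M" "code u = code w"
      then have uL: "u \<in> L" "w \<in> L" by (auto simp: M)
      show "u = w"
      proof (rule monomials_eqI)
        fix k assume k: "1 \<le> k" "k \<le> n"
        consider "k = 1" | "2 \<le> k" "k \<le> Suc d" | "k > Suc d" using k by linarith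
        then show "tail_degree n u k = tail_degree n w k"
        proof cases
          case 1
          then show ?thesis using stable_setD(2)[OF L] uL by simp
        next
          case 2
          then have "d + 1 - k < d" "d + 1 - (d + 1 - k) = k" by auto
          then have "code x ! (d + 1 - k) = tail_degree n x k - 1" for x
            by (simp only: code_def nth_map length_upt nth_upt minus_nat.diff_0 add_0)
          from this[of u] this[of w] have "tail_degree n u k - 1 = tail_degree n w k - 1"
            using uw(3) by simp
          then show ?thesis using pos[OF uw(1) 2(2)] pos[OF uw(2) 2(2)] by simp
        next
          case 3
          then show ?thesis using zero uw by simp
        qed
      qed (use stable_setD(1)[OF L] uL in auto)
    qed
  next
    fix v assume "v \<in> code ` M"
    then obtain u where u: "u \<in> M" "v = code u" by blast
    have "sorted v"
      unfolding u code_def sorted_map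
      by (rule sorted_wrt_mono_rel[OF _ sorted_upt])
        (auto intro!: diff_le_mono tail_degree_antimono)
    moreover have "v ! i < tail_degree n u (d + 1 - i)" if "i < d" for i
      using that pos[OF u(1), of "d + 1 - i"] by (simp add: u code_def)
    ultimately show "v \<in> tail_lists n L d"
      using u by (auto simp: tail_lists_def M code_def)
  next
    fix v assume "v \<in> tail_lists n L d"
    then obtain u where v: "length v = d" "sorted v" and u: "u \<in> L"
      and less: "\<And>i. i < d \<Longrightarrow> v ! i < tail_degree n u (d + 1 - i)"
      by (auto simp: tail_lists_def)
    define T where "T k = (if k \<le> 1 then j else if k \<le> Suc d then Suc (v ! (d + 1 - k)) else 0)" for k
    have le: "T k \<le> tail_degree n u k" if k: "1 \<le> k" for k
    proof -
      consider "k = 1" | "2 \<le> k" "k \<le> Suc d" | "k > Suc d" using k by linarith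
      then show ?thesis
      proof cases
        case 1
        then show ?thesis using stable_setD(2)[OF L u] by (simp add: T_def)
      next
        case 2
        then have "d + 1 - k < d" by linarith
        then show ?thesis using 2 less[of "d + 1 - k"] by (simp add: T_def Suc_le_eq)
      qed (simp add: T_def)
    qed
    have "\<exists>w\<in>monomials n. \<forall>k. 1 \<le> k \<and> k \<le> n \<longrightarrow> tail_degree n w k = T k"
    proof (rule exists_tail_degree)
      fix k assume k: "1 \<le> k" "k \<le> n"
      show "T (Suc k) \<le> T k"
      proof (cases "k = 1")
        case True
        then show ?thesis
          using le[of "Suc k"] tail_degree_antimono[of 1 "Suc k" n u] stable_setD(2)[OF L u]
          by (simp add: T_def)
      next
        case False
        then show ?thesis
          using k v by (auto simp: T_def intro!: sorted_nth_mono)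
      qed
    qed (use \<open>d < n\<close> in \<open>simp add: T_def\<close>)
    then obtain w where w: "w \<in> monomials n"
      and tail: "\<And>k. 1 \<le> k \<Longrightarrow> k \<le> n \<Longrightarrow> tail_degree n w k = T k"
      by blast
    have "w \<in> L"
      by (rule stable_set_dominance[OF L u w])
        (use le tail \<open>d < n\<close> in \<open>auto simp: mono_degree_eq_tail_degree[OF w] T_def\<close>)
    moreover have "tail_degree n w (Suc d) > 0" using tail[of "Suc d"] \<open>d < n\<close> \<open>j \<ge> 1\<close>
      by (simp add: T_def)
    moreover have "tail_degree n w (Suc (Suc d)) = 0"
      using tail[of "Suc (Suc d)"] by (cases "Suc d < n") (auto simp: T_def tail_degree_beyond)
    moreover have "v = code w"
      using tail v \<open>d < n\<close> by (intro nth_equalityI) (auto simp: code_def T_def)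
    ultimately show "v \<in> code ` M" by (auto simp: M)
  qed
qed

lemma card_tail_lists_Suc_le:
  assumes "stable_set n j L" and "d \<ge> 1"
  shows "card (tail_lists n L (Suc d)) \<le> macaulay_power (card (tail_lists n L d)) d"
proof -
  obtain k where k: "macaulay_rep d (card (tail_lists n L d)) k"
    using macaulay_rep_exists[OF \<open>d \<ge> 1\<close>] by blast
  have "card (tail_lists n L (Suc d)) \<le> (\<Sum>v\<in>tail_lists n L d. Suc (hd v))"
  proof (rule card_extension_le[OF finite_tail_lists[OF assms(1)] \<open>d \<ge> 1\<close>])
    fix w assume w: "w \<in> tail_lists n L (Suc d)"
    then obtain t v where "w = t # v" by (cases w) (auto simp: tail_lists_def)
    then show "\<exists>t v. w = t # v \<and> v \<in> tail_lists n L d"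
      using tail_lists_tl w by blast
  qed (auto simp: tail_lists_def)
  also have "\<dots> \<le> macaulay_power (card (tail_lists n L d)) d"
    unfolding macaulay_power_eq[OF k]
    by (rule order_ideal_growth[OF \<open>d \<ge> 1\<close> finite_tail_lists[OF assms(1)] order_ideal_tail_lists k])
  finally show ?thesis .
qed

lemma card_tail_lists_1_le:
  assumes "stable_set n j L"
  shows "card (tail_lists n L 1) \<le> j"
proof -
  have "tail_lists n L 1 \<subseteq> (\<lambda>x. [x]) ` {..<j}"
  proof
    fix v assume "v \<in> tail_lists n L 1"
    then obtain u where "length v = 1" "u \<in> L" "v ! 0 < tail_degree n u 2"
      by (auto simp: tail_lists_def numeral_2_eq_2)
    then show "v \<in> (\<lambda>x. [x]) ` {..<j}"
      using tail_degree_antimono[of 1 2 n u] stable_setD(2)[OF assms, of u]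
      by (cases v) auto
  qed
  then have "card (tail_lists n L 1) \<le> card {..<j}"
    by (rule surj_card_le[rotated]) simp
  then show ?thesis by simp
qed

section \<open>Monomial ideals and their minimal generators\<close>

lemma finite_monomials_degree: "finite {u \<in> monomials n. mono_degree u = j}"
proof (rule finite_imageD)
  let ?U = "{u \<in> monomials n. mono_degree u = j}"
  let ?t = "\<lambda>u. map (tail_degree n u) [1..<Suc n]"
  show "finite (?t ` ?U)"
  proof (rule finite_subset)
    show "?t ` ?U \<subseteq> {v. set v \<subseteq> {..j} \<and> length v = n}"
      using tail_degree_antimono[of 1] by (auto simp: mono_degree_eq_tail_degree simp del: upt_Suc)
  qed (rule finite_lists_length_eq, simp)
  show "inj_on ?t ?U"
    by (rule inj_onI, rule monomials_eqI) (auto simp del: upt_Suc)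
qed

text \<open>
  The monomials in \<open>x\<^sub>1, \<dots>, x\<^sub>n\<close> divisible by a monomial in \<open>A\<close>.
\<close>

definition multiples :: "nat \<Rightarrow> (nat \<Rightarrow>\<^sub>0 nat) set \<Rightarrow> (nat \<Rightarrow>\<^sub>0 nat) set" where
  "multiples n A = {a + b |a b. a \<in> A \<and> b \<in> monomials n}"

lemma monomials_add: "a \<in> monomials n \<Longrightarrow> b \<in> monomials n \<Longrightarrow> a + b \<in> monomials n"
  using keys_add[of a b] unfolding monomials_def by blast

lemma zero_in_monomials: "0 \<in> monomials n"
  by (simp add: monomials_def)

lemma multiples_subset_monomials: "A \<subseteq> monomials n \<Longrightarrow> multiples n A \<subseteq> monomials n"
  by (auto simp: multiples_def intro: monomials_add)

lemma subset_multiples: "A \<subseteq> multiples n A"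
proof
  fix a assume "a \<in> A"
  then have "a = a + 0 \<and> a \<in> A \<and> (0 :: nat \<Rightarrow>\<^sub>0 nat) \<in> monomials n" by (simp add: zero_in_monomials)
  then show "a \<in> multiples n A" unfolding multiples_def by blast
qed

lemma multiples_add: "a \<in> multiples n A \<Longrightarrow> b \<in> monomials n \<Longrightarrow> a + b \<in> multiples n A"
proof -
  assume "a \<in> multiples n A" and b: "b \<in> monomials n"
  then obtain a' b' where "a = a' + b'" "a' \<in> A" "b' \<in> monomials n"
    by (auto simp: multiples_def)
  then have "a + b = a' + (b' + b) \<and> a' \<in> A \<and> b' + b \<in> monomials n"
    using b by (simp add: add.assoc monomials_add)
  then show "a + b \<in> multiples n A" unfolding multiples_def by blast
qed

lemma mono_poly_carrier:
  "A \<subseteq> monomials n \<Longrightarrow> mono_poly ` A \<subseteq> carrier (polynomial_ring n)"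
  by (auto simp: polynomial_ring_def mono_poly_def)

lemma ideal_multiples:
  assumes A: "A \<subseteq> monomials n"
  shows "ideal {f :: (nat \<Rightarrow>\<^sub>0 nat) \<Rightarrow>\<^sub>0 'k::field. Poly_Mapping.keys f \<subseteq> multiples n A} (polynomial_ring n)"
    (is "ideal ?J ?R")
proof -
  interpret R: cring ?R by (rule polynomial_ring_cring)
  have J: "f \<in> carrier ?R" if "f \<in> ?J" for f
    using that multiples_subset_monomials[OF A] by (auto simp: polynomial_ring_def)
  have mult: "f * g \<in> ?J" if "f \<in> ?J" "g \<in> carrier ?R" for f g
  proof -
    have "a + b \<in> multiples n A" if "a \<in> Poly_Mapping.keys f" "b \<in> Poly_Mapping.keys g" for a b
      using that \<open>f \<in> ?J\<close> \<open>g \<in> carrier ?R\<close> multiples_add[of a n A b]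
      by (auto simp: polynomial_ring_def)
    then show ?thesis using keys_mult[of f g] by blast
  qed
  show ?thesis
  proof (rule idealI[OF R.ring_axioms])
    show "subgroup ?J (add_monoid ?R)"
    proof
      fix f assume f: "f \<in> ?J"
      have "\<ominus>\<^bsub>?R\<^esub> f = - f"
        by (rule R.minus_equality) (use J[OF f] in \<open>auto simp: polynomial_ring_def\<close>)
      then show "inv\<^bsub>add_monoid ?R\<^esub> f \<in> ?J"
        using f by (simp add: a_inv_def)
    next
      fix f g assume "f \<in> ?J" "g \<in> ?J"
      then show "f \<otimes>\<^bsub>add_monoid ?R\<^esub> g \<in> ?J"
        using keys_add[of f g] by (auto simp: polynomial_ring_def)
    qed (use J in \<open>auto simp: polynomial_ring_def\<close>)
  next
    fix f g assume "f \<in> ?J" "g \<in> carrier ?R"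
    then show "g \<otimes>\<^bsub>?R\<^esub> f \<in> ?J" "f \<otimes>\<^bsub>?R\<^esub> g \<in> ?J"
      using mult[of f g] by (simp_all add: polynomial_ring_def mult.commute)
  qed
qed

lemma Idl_mono_poly:
  assumes A: "A \<subseteq> monomials n"
  shows "Idl\<^bsub>polynomial_ring n\<^esub> (mono_poly ` A) =
    {f :: (nat \<Rightarrow>\<^sub>0 nat) \<Rightarrow>\<^sub>0 'k::field. Poly_Mapping.keys f \<subseteq> multiples n A}"
    (is "?I = ?J")
proof
  let ?R = "polynomial_ring n :: ((nat \<Rightarrow>\<^sub>0 nat) \<Rightarrow>\<^sub>0 'k) ring"
  interpret R: cring ?R by (rule polynomial_ring_cring)
  show "?I \<subseteq> ?J"
    by (rule R.genideal_minimal[OF ideal_multiples[OF A]])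
      (use subset_multiples[of A n] in \<open>auto simp: mono_poly_def\<close>)
  interpret I: ideal ?I ?R by (rule R.genideal_ideal[OF mono_poly_carrier[OF A]])
  have single: "Poly_Mapping.single c x \<in> ?I" if c: "c \<in> multiples n A" for c x
  proof -
    obtain a b where ab: "c = a + b" "a \<in> A" "b \<in> monomials n"
      using c by (auto simp: multiples_def)
    have "mono_poly a \<in> ?I"
      using R.genideal_self[OF mono_poly_carrier[OF A]] ab by blast
    then have "mono_poly a \<otimes>\<^bsub>?R\<^esub> Poly_Mapping.single b x \<in> ?I"
      by (rule I.I_r_closed) (use ab in \<open>auto simp: polynomial_ring_def\<close>)
    then show ?thesis
      by (simp add: polynomial_ring_def mono_poly_def mult_single ab)
  qed
  show "?J \<subseteq> ?I"
  proof
    fix f assume f: "f \<in> ?J"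
    have "(\<Sum>c\<in>F. Poly_Mapping.single c (Poly_Mapping.lookup f c)) \<in> ?I"
      if "finite F" "F \<subseteq> multiples n A" for F
      using that
    proof (induction F rule: finite_induct)
      case empty
      then show ?case using I.zero_closed by (simp add: polynomial_ring_def)
    next
      case (insert c F)
      then show ?case
        using I.a_closed[OF single[of c]] by (simp add: polynomial_ring_def)
    qed
    moreover have "f = (\<Sum>c\<in>Poly_Mapping.keys f. Poly_Mapping.single c (Poly_Mapping.lookup f c))"
      by (rule poly_mapping_eqI) (auto simp: lookup_sum lookup_single when_def in_keys_iff)
    ultimately show "f \<in> ?I"
      using f by (metis (no_types, lifting) finite_keys mem_Collect_eq)
  qed
qed

lemma monomial_idealE:
  fixes I :: "((nat \<Rightarrow>\<^sub>0 nat) \<Rightarrow>\<^sub>0 'k::field) set"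
  assumes "monomial_ideal n I"
  obtains A where "A \<subseteq> monomials n" "I = {f. Poly_Mapping.keys f \<subseteq> multiples n A}"
proof -
  obtain A where "A \<subseteq> monomials n" "I = Idl\<^bsub>polynomial_ring n\<^esub> (mono_poly ` A)"
    using assms unfolding monomial_ideal_def by blast
  then show thesis using that[of A] Idl_mono_poly[of A n] by simp
qed

lemma mono_degree_add:
  assumes "a \<in> monomials n" "b \<in> monomials n"
  shows "mono_degree (a + b) = mono_degree a + mono_degree b"
  using assms monomials_add[OF assms] by (simp add: mono_degree_eq_tail_degree tail_degree_add)

lemma mono_degree_eq_0: "mono_degree a = 0 \<Longrightarrow> a = 0"
  by (rule poly_mapping_eqI) (auto simp: mono_degree_def in_keys_iff)

text \<open>
  Since all monomials in \<open>G\<close> have the same degree, none of them has a proper divisor among the multiples of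
  \<open>G\<close>; hence each belongs to every set of monomials with the same multiples.
\<close>

lemma generators_subset:
  assumes G: "G \<subseteq> {u \<in> monomials n. mono_degree u = j}" and H: "H \<subseteq> monomials n"
    and eq: "multiples n H = multiples n G"
  shows "G \<subseteq> H"
proof
  fix g assume g: "g \<in> G"
  then have "g \<in> multiples n H" using subset_multiples[of G n] eq by blast
  then obtain h b where h: "g = h + b" "h \<in> H" "b \<in> monomials n"
    by (auto simp: multiples_def)
  then have "h \<in> multiples n G" using subset_multiples[of H n] eq by blast
  then obtain g' b' where g': "h = g' + b'" "g' \<in> G" "b' \<in> monomials n"
    by (auto simp: multiples_def)
  have "mono_degree g = mono_degree h + mono_degree b"
    using h H by (auto simp: mono_degree_add)
  moreover have "mono_degree h = mono_degree g' + mono_degree b'"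
    using g' G by (auto simp: mono_degree_add)
  moreover have "mono_degree g = j" "mono_degree g' = j"
    using g g' G by auto
  ultimately have "mono_degree b = 0" by linarith
  then show "g \<in> H" using h mono_degree_eq_0[of b] by simp
qed

lemma Idl_mono_poly_eq_iff:
  assumes "A \<subseteq> monomials n" "B \<subseteq> monomials n"
  shows "(Idl\<^bsub>polynomial_ring n\<^esub> (mono_poly ` A) :: ((nat \<Rightarrow>\<^sub>0 nat) \<Rightarrow>\<^sub>0 'k::field) set) =
      Idl\<^bsub>polynomial_ring n\<^esub> (mono_poly ` B) \<longleftrightarrow> multiples n A = multiples n B" (is "?l = ?r \<longleftrightarrow> _")
proof
  assume eq: "?l = ?r"
  have "c \<in> multiples n A \<longleftrightarrow> c \<in> multiples n B" for c
  proof -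
    have "(mono_poly c :: (nat \<Rightarrow>\<^sub>0 nat) \<Rightarrow>\<^sub>0 'k) \<in> ?l \<longleftrightarrow> (mono_poly c :: (nat \<Rightarrow>\<^sub>0 nat) \<Rightarrow>\<^sub>0 'k) \<in> ?r"
      using eq by simp
    then show ?thesis unfolding Idl_mono_poly[OF assms(1)] Idl_mono_poly[OF assms(2)]
      by (simp add: mono_poly_def)
  qed
  then show "multiples n A = multiples n B" by blast
qed (use assms in \<open>simp add: Idl_mono_poly\<close>)

lemma min_gens_equigenerated:
  assumes G: "G \<subseteq> {u \<in> monomials n. mono_degree u = j}"
  shows "min_gens n (Idl\<^bsub>polynomial_ring n\<^esub> (mono_poly ` G) :: ((nat \<Rightarrow>\<^sub>0 nat) \<Rightarrow>\<^sub>0 'k::field) set) = G"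
    (is "min_gens n ?J = G")
  unfolding min_gens_def
proof (rule the_equality)
  have Gm: "G \<subseteq> monomials n" using G by blast
  have sub: "G \<subseteq> H" if "H \<subseteq> monomials n" "Idl\<^bsub>polynomial_ring n\<^esub> (mono_poly ` H) = ?J" for H
    using generators_subset[OF G that(1)] that(2) Idl_mono_poly_eq_iff[OF that(1) Gm] by blast
  show "G \<subseteq> monomials n \<and> Idl\<^bsub>polynomial_ring n\<^esub> (mono_poly ` G) = ?J \<and>
      (\<forall>H. H \<subset> G \<longrightarrow> Idl\<^bsub>polynomial_ring n\<^esub> (mono_poly ` H) \<noteq> ?J)"
    using Gm sub by blast
  fix H assume "H \<subseteq> monomials n \<and> Idl\<^bsub>polynomial_ring n\<^esub> (mono_poly ` H) = ?J \<and>
      (\<forall>H'. H' \<subset> H \<longrightarrow> Idl\<^bsub>polynomial_ring n\<^esub> (mono_poly ` H') \<noteq> ?J)"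
  then show "H = G" using sub[of H] by blast
qed

text \<open>
  The monomials of degree \<open>j\<close> in \<open>I\<close>; for a monomial ideal \<open>I\<close> they are the minimal generators of the
  ideal generated by the degree-\<open>j\<close> part of \<open>I\<close>.
\<close>

definition degree_monomials ::
    "nat \<Rightarrow> nat \<Rightarrow> ((nat \<Rightarrow>\<^sub>0 nat) \<Rightarrow>\<^sub>0 'k::field) set \<Rightarrow> (nat \<Rightarrow>\<^sub>0 nat) set" where
  "degree_monomials n j I = {u \<in> monomials n. mono_degree u = j \<and> mono_poly u \<in> I}"

lemma finite_degree_monomials: "finite (degree_monomials n j I)"
  by (rule finite_subset[OF _ finite_monomials_degree[of n j]]) (auto simp: degree_monomials_def)

lemma degree_part_ideal_eq:
  fixes I :: "((nat \<Rightarrow>\<^sub>0 nat) \<Rightarrow>\<^sub>0 'k::field) set"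
  assumes "monomial_ideal n I"
  shows "degree_part_ideal n j I = Idl\<^bsub>polynomial_ring n\<^esub> (mono_poly ` degree_monomials n j I)"
proof -
  let ?R = "polynomial_ring n :: ((nat \<Rightarrow>\<^sub>0 nat) \<Rightarrow>\<^sub>0 'k) ring"
  let ?L = "degree_monomials n j I"
  interpret R: cring ?R by (rule polynomial_ring_cring)
  obtain A where A: "A \<subseteq> monomials n" "I = {f. Poly_Mapping.keys f \<subseteq> multiples n A}"
    using assms(1) by (rule monomial_idealE)
  let ?S = "{f \<in> I. \<forall>a\<in>Poly_Mapping.keys f. mono_degree a = j}"
  have Lm: "?L \<subseteq> monomials n" by (auto simp: degree_monomials_def)
  have SR: "?S \<subseteq> carrier ?R"
    using A multiples_subset_monomials[OF A(1)] by (auto simp: polynomial_ring_def)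
  have keys: "Poly_Mapping.keys f \<subseteq> ?L" if f: "f \<in> ?S" for f
  proof
    fix a assume "a \<in> Poly_Mapping.keys f"
    then show "a \<in> ?L"
      using f A multiples_subset_monomials[OF A(1)]
      by (auto simp: degree_monomials_def mono_poly_def)
  qed
  show ?thesis
    unfolding degree_part_ideal_def
  proof
    show "Idl\<^bsub>?R\<^esub> ?S \<subseteq> Idl\<^bsub>?R\<^esub> (mono_poly ` ?L)"
    proof (rule R.genideal_minimal[OF R.genideal_ideal[OF mono_poly_carrier[OF Lm]]])
      show "?S \<subseteq> Idl\<^bsub>?R\<^esub> (mono_poly ` ?L)"
        unfolding Idl_mono_poly[OF Lm] using keys subset_multiples[of ?L n] by blast
    qed
    show "Idl\<^bsub>?R\<^esub> (mono_poly ` ?L) \<subseteq> Idl\<^bsub>?R\<^esub> ?S"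
      by (rule R.subset_Idl_subset[OF SR]) (auto simp: degree_monomials_def mono_poly_def)
  qed
qed

lemma gens_matrix_eq_card:
  assumes "monomial_ideal n I" "j \<ge> 1"
  shows "gens_matrix n I i j = card {u \<in> degree_monomials n j I. u \<noteq> 0 \<and> max_var u = i}"
proof -
  have "degree_monomials n j I \<subseteq> {u \<in> monomials n. mono_degree u = j}"
    by (auto simp: degree_monomials_def)
  then show ?thesis
    using assms by (simp add: gens_matrix_def num_gens_def degree_part_ideal_eq min_gens_equigenerated)
qed

section \<open>The matrix of generators\<close>

lemma stable_set_degree_monomials:
  assumes "strongly_stable n I"
  shows "stable_set n j (degree_monomials n j I)"
  unfolding stable_set_def
proof (intro conjI ballI allI impI)
  fix u q i
  assume u: "u \<in> degree_monomials n j I" and q: "q \<in> Poly_Mapping.keys u" and i: "1 \<le> i \<and> i < q"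
  define s where "s = u - Poly_Mapping.single q 1"
  have us: "u = s + Poly_Mapping.single q 1"
    unfolding s_def using q
    by (intro poly_mapping_eqI) (auto simp: lookup_add lookup_minus lookup_single when_def in_keys_iff)
  have um: "u \<in> monomials n" using u by (simp add: degree_monomials_def)
  then have "q \<le> n" using q by (auto simp: monomials_def)
  have sm: "s \<in> monomials n"
    using um by (auto simp: monomials_def s_def in_keys_iff lookup_minus subset_iff)
  have singles: "Poly_Mapping.single q (1::nat) \<in> monomials n" "Poly_Mapping.single i (1::nat) \<in> monomials n"
    using i \<open>q \<le> n\<close> by (auto simp: monomials_def)
  have "mono_degree (s + Poly_Mapping.single i 1) = mono_degree u"
    using us sm singles by (simp add: mono_degree_add) (simp add: mono_degree_def)
  then show "u - Poly_Mapping.single q 1 + Poly_Mapping.single i 1 \<in> degree_monomials n j I"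
  proof -
    have "mono_poly (u - Poly_Mapping.single q 1 + Poly_Mapping.single i 1) \<in> I"
      using assms u q i um unfolding strongly_stable_def degree_monomials_def by blast
    then show ?thesis
      using u monomials_add[OF sm singles(2)] \<open>mono_degree _ = _\<close>
      unfolding degree_monomials_def s_def by simp
  qed
qed (auto simp: degree_monomials_def)

lemma degree_monomials_times_var:
  assumes "monomial_ideal n I" "u \<in> degree_monomials n j I" "i \<in> {1..n}"
  shows "u + Poly_Mapping.single i 1 \<in> degree_monomials n (Suc j) I"
proof -
  obtain A where A: "A \<subseteq> monomials n" "I = {f. Poly_Mapping.keys f \<subseteq> multiples n A}"
    using assms(1) by (rule monomial_idealE)
  have i: "Poly_Mapping.single i (1::nat) \<in> monomials n" using assms(3) by (auto simp: monomials_def)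
  have "mono_degree (Poly_Mapping.single i (1::nat)) = 1" by (simp add: mono_degree_def)
  then show ?thesis
    using assms(2) i multiples_add[OF _ i]
    by (auto simp: degree_monomials_def A mono_poly_def monomials_add mono_degree_add)
qed

text \<open>
  Multiplication by \<open>x\<^sub>i\<close> maps the monomials of degree \<open>j - 1\<close> in \<open>I\<close> with largest variable among
  \<open>x\<^sub>1, \<dots>, x\<^sub>i\<close> injectively to monomials of degree \<open>j\<close> in \<open>I\<close> with largest variable \<open>x\<^sub>i\<close>.
\<close>

lemma gens_matrix_sum_le:
  fixes I :: "((nat \<Rightarrow>\<^sub>0 nat) \<Rightarrow>\<^sub>0 'k::field) set"
  assumes mi: "monomial_ideal n I" and i: "i \<in> {1..n}" and "j \<ge> 1"
  shows "(\<Sum>q=1..i. gens_matrix n I q (j - 1)) \<le> gens_matrix n I i j"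
proof (cases "j = 1")
  case True
  then show ?thesis by (simp add: gens_matrix_def)
next
  case False
  define M where "M j q = {u \<in> degree_monomials n j I. u \<noteq> 0 \<and> max_var u = q}" for j q
  have finM: "finite (M j q)" for j q
    using finite_degree_monomials[of n j I] by (simp add: M_def)
  have M: "u \<in> M j q \<longleftrightarrow>
      u \<in> degree_monomials n j I \<and> tail_degree n u q > 0 \<and> tail_degree n u (Suc q) = 0" for u j q
    unfolding M_def using max_var_iff_tail_degree[of u n q] by (auto simp: degree_monomials_def)
  have "(\<Sum>q=1..i. gens_matrix n I q (j - 1)) = (\<Sum>q=1..i. card (M (j - 1) q))"
    using False \<open>j \<ge> 1\<close> by (simp add: gens_matrix_eq_card[OF mi] M_def)
  also have "\<dots> = card (\<Union>q\<in>{1..i}. M (j - 1) q)"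
    by (rule card_UN_disjoint[symmetric]) (simp_all add: finM, auto simp: M_def)
  also have "\<dots> \<le> card (M j i)"
  proof (rule card_inj_on_le[OF _ _ finM])
    show "inj_on (\<lambda>u. u + Poly_Mapping.single i 1) (\<Union>q\<in>{1..i}. M (j - 1) q)"
      by (auto simp: inj_on_def)
    show "(\<lambda>u. u + Poly_Mapping.single i 1) ` (\<Union>q\<in>{1..i}. M (j - 1) q) \<subseteq> M j i"
    proof clarify
      fix u q assume q: "q \<in> {1..i}" and u: "u \<in> M (j - 1) q"
      have "tail_degree n u (Suc i) \<le> tail_degree n u (Suc q)"
        using q by (intro tail_degree_antimono) auto
      then show "u + Poly_Mapping.single i 1 \<in> M j i"
        using u i degree_monomials_times_var[OF mi, of u "j - 1" i] \<open>j \<ge> 1\<close>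
        by (simp add: M tail_degree_add tail_degree_single)
    qed
  qed
  finally show ?thesis using \<open>j \<ge> 1\<close> by (simp add: gens_matrix_eq_card[OF mi] M_def)
qed

theorem proposition2p6:
  fixes n :: nat and I :: "((nat \<Rightarrow>\<^sub>0 nat) \<Rightarrow>\<^sub>0 'k::field) set"
  assumes "n \<ge> 1"
    and "strongly_stable n I"
  shows "(\<forall>j\<ge>1. (\<exists>i\<in>{1..n}. gens_matrix n I i j \<noteq> 0) \<longrightarrow>
            O_sequence n (\<lambda>i. gens_matrix n I i j) \<and> (n \<ge> 2 \<longrightarrow> gens_matrix n I 2 j \<le> j))
       \<and> (\<forall>i\<in>{1..n}. \<forall>j\<ge>1. gens_matrix n I i j \<ge> (\<Sum>q=1..i. gens_matrix n I q (j - 1)))"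
proof (intro conjI allI impI ballI)
  have mi: "monomial_ideal n I" using assms(2) by (simp add: strongly_stable_def)
  show "gens_matrix n I i j \<ge> (\<Sum>q=1..i. gens_matrix n I q (j - 1))"
    if "i \<in> {1..n}" "j \<ge> 1" for i j
    by (rule gens_matrix_sum_le[OF mi that])
  fix j :: nat
  assume j: "j \<ge> 1" and "\<exists>i\<in>{1..n}. gens_matrix n I i j \<noteq> 0"
  define L where "L = degree_monomials n j I"
  have L: "stable_set n j L"
    unfolding L_def by (rule stable_set_degree_monomials[OF assms(2)])
  have row: "gens_matrix n I (Suc d) j = card (tail_lists n L d)" if "d < n" for d
    using card_tail_lists[OF L j that] gens_matrix_eq_card[OF mi j] by (simp add: L_def)
  have "L \<noteq> {}"
    using \<open>\<exists>i\<in>{1..n}. _\<close> gens_matrix_eq_card[OF mi j] by (auto simp: L_def)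
  then have "tail_lists n L 0 = {[]}" by (auto simp: tail_lists_def)
  then have "gens_matrix n I 1 j = 1" using row[of 0] assms(1) by simp
  moreover have "gens_matrix n I (i + 1) j \<le> macaulay_power (gens_matrix n I i j) (i - 1)"
    if i: "i \<in> {2..n - 1}" for i
  proof -
    obtain d where d: "i = Suc d" "d \<ge> 1" "Suc d < n" using i by (cases i) auto
    then show ?thesis using row[of d] row[of "Suc d"] card_tail_lists_Suc_le[OF L, of d] by simp
  qed
  ultimately show "O_sequence n (\<lambda>i. gens_matrix n I i j)"
    by (simp add: O_sequence_def)
  show "gens_matrix n I 2 j \<le> j" if "n \<ge> 2"
    using row[of 1] that card_tail_lists_1_le[OF L] by (simp add: numeral_2_eq_2)
qed

end
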